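(* Let $A\in\mathbb{R}^{n\times n}$, $\boldsymbol x_{\mathrm{eq}}\in\mathbb{R}^n$, let $P\in\mathbb{R}^{n\times n}$ be symmetric positive definite, $V(\boldsymbol x)=(\boldsymbol x-\boldsymbol x_{\mathrm{eq}})^\top P(\boldsymbol x-\boldsymbol x_{\mathrm{eq}})$, $\tau_{\min}>0$, $\lambda>0$, and $$G_1:=\sup_{\boldsymbol x\neq \boldsymbol 0}\sqrt{\frac{\boldsymbol x^\top (e^{A\tau_{\min}})^\top P\, e^{A\tau_{\min}}\boldsymbol x}{\boldsymbol x^\top P\boldsymbol x}}.$$ For a schedule $\pi$ (as defined in the context) with $N$ jam ticks and unjammed epochs of durations $\{\tau^d_j\}_{j=1}^M$, started from $\boldsymbol x_0$ with $V(\boldsymbol x_0)=V_0$, define $$\overline V(\pi):=V_0\,G_1^{2N}\prod_{j=1}^{M}e^{-\lambda\tau^d_j}.$$ Then the terminal state $\boldsymbol x_T$ reached under $\pi$ satisfies $V^\pi(\boldsymbol x_T)\le \overline V(\pi)$. Moreover, among all schedules with a fixed jam count $N$ (from the same $V_0$), $\overline V$ is maximized by the contiguous block ($M=0$), with maximal value $V_0G_1^{2N}$.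
   Context: Setting: the plant is $\dot{\boldsymbol x}=A\boldsymbol x+B\boldsymbol u$ with equilibrium $(\boldsymbol x_{\mathrm{eq}},\boldsymbol u_{\mathrm{eq}})$, $A\boldsymbol x_{\mathrm{eq}}+B\boldsymbol u_{\mathrm{eq}}=\boldsymbol 0$, controlled by a self-triggered controller (STC) and attacked by a jammer that makes the actuator hold its last input. A schedule $\pi$ is a finite sequence, in any order, of $N$ jam ticks (each of length $\tau_{\min}$) and $M\ge 0$ unjammed epochs with durations $\tau^d_1,\dots,\tau^d_M\in\{\tau_{\min},2\tau_{\min},\dots,N_\tau\tau_{\min}\}$, for a fixed integer $N_\tau\ge1$. The contiguous block is the schedule consisting of $N$ jam ticks and no unjammed epoch ($M=0$). Along a schedule the state evolves as follows. (i) Over each jam tick the held input is $\boldsymbol u_{\mathrm{eq}}$, so the deviation $\boldsymbol x-\boldsymbol x_{\mathrm{eq}}$ is multiplied by $e^{A\tau_{\min}}$. (ii) Over each unjammed epoch of duration $\tau^d$ the STC satisfies the exponential-decay Lyapunov contract: the value of $V$ at the end of the epoch is at most $e^{-\lambda\tau^d}$ times the value of $V$ at its start. The closed-loop map over an unjammed epoch is not assumed linear. $V^\pi(\boldsymbol x_T)$ denotes the value of $V$ at the state $\boldsymbol x_T$ reached at the end of the schedule $\pi$. *)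

theory Defs
  imports "HOL-Analysis.Analysis"
begin

section \<open>Matrix exponential\<close>

text \<open>On \<^typ>\<open>real ^ 'n ^ 'n\<close> the overloaded \<open>*\<close> is componentwise, so the library's
  \<open>exp\<close> and \<open>^\<close> are not the matrix operations; both are defined here via \<open>**\<close>.\<close>

definition matpow :: "real ^ 'n ^ 'n \<Rightarrow> nat \<Rightarrow> real ^ 'n ^ 'n" where
  "matpow A k = (((**) A) ^^ k) (mat 1)"

definition mexp :: "real ^ 'n ^ 'n \<Rightarrow> real ^ 'n ^ 'n" where
  "mexp A = (\<Sum>k. (1 / fact k) *\<^sub>R matpow A k)"

lemma matpow_0: "matpow A 0 = mat 1"
  and matpow_Suc: "matpow A (Suc k) = A ** matpow A k"
  by (simp_all add: matpow_def)

lemma bounded_bilinear_matrix_mult: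
  "bounded_bilinear ((**) :: real ^ 'n ^ 'n \<Rightarrow> real ^ 'n ^ 'n \<Rightarrow> real ^ 'n ^ 'n)"
  unfolding bilinear_conv_bounded_bilinear[symmetric] bilinear_def
proof (intro conjI allI linearI)
  fix X Y Z :: "real ^ 'n ^ 'n" and r :: real
  show "X ** (Y + Z) = X ** Y + X ** Z" "(Y + Z) ** X = Y ** X + Z ** X"
    by (fact matrix_add_ldistrib, simp add: vec_eq_iff matrix_matrix_mult_def distrib_right sum.distrib)
  show "X ** (r *\<^sub>R Y) = r *\<^sub>R (X ** Y)" "(r *\<^sub>R Y) ** X = r *\<^sub>R (Y ** X)"
    by (simp_all add: vec_eq_iff matrix_matrix_mult_def sum_distrib_left mult.left_commute mult.assoc)
qed

lemma bounded_bilinear_matrix_vector_mult: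
  "bounded_bilinear ((*v) :: real ^ 'n ^ 'n \<Rightarrow> real ^ 'n \<Rightarrow> real ^ 'n)"
  unfolding bilinear_conv_bounded_bilinear[symmetric] bilinear_def
proof (intro conjI allI linearI)
  fix X Y :: "real ^ 'n ^ 'n" and x y :: "real ^ 'n" and r :: real
  show "X *v (x + y) = X *v x + X *v y" "(X + Y) *v x = X *v x + Y *v x"
    by (fact matrix_vector_right_distrib, fact matrix_vector_mult_add_rdistrib)
  show "X *v (r *\<^sub>R x) = r *\<^sub>R (X *v x)" "(r *\<^sub>R X) *v x = r *\<^sub>R (X *v x)"
    by (simp_all add: matrix_vector_mult_scaleR scaleR_matrix_vector_assoc)
qed

lemma matpow_commute: "A ** matpow A k = matpow A k ** A"
proof (induction k)
  case (Suc k)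
  show ?case by (simp only: matpow_Suc matrix_mul_assoc[symmetric] Suc[symmetric])
qed (simp add: matpow_0)

lemma matpow_scaleR: "matpow (t *\<^sub>R A) k = t ^ k *\<^sub>R matpow A k"
proof (induction k)
  case (Suc k)
  then show ?case
    by (simp add: matpow_Suc bounded_bilinear.scaleR_left[OF bounded_bilinear_matrix_mult]
        bounded_bilinear.scaleR_right[OF bounded_bilinear_matrix_mult])
qed (simp add: matpow_0)

lemma summable_mexp:
  fixes A :: "real ^ 'n ^ 'n"
  shows "summable (\<lambda>k. (1 / fact k) *\<^sub>R matpow A k)"
proof -
  obtain K where K: "K > 0" "\<And>(X :: real ^ 'n ^ 'n) (Y :: real ^ 'n ^ 'n). norm (X ** Y) \<le> norm X * norm Y * K"
    using bounded_bilinear.pos_bounded[OF bounded_bilinear_matrix_mult[where ?'n = 'n]] by blast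
  have le: "norm (matpow A k) \<le> norm (mat 1 :: real ^ 'n ^ 'n) * (norm A * K) ^ k" for k
  proof (induction k)
    case (Suc k)
    have "norm (matpow A (Suc k)) \<le> (norm A * K) * norm (matpow A k)"
      using K(2)[of A "matpow A k"] by (simp only: matpow_Suc mult.commute mult.left_commute)
    also have "\<dots> \<le> (norm A * K) * (norm (mat 1 :: real ^ 'n ^ 'n) * (norm A * K) ^ k)"
      using Suc K(1) by (intro mult_left_mono) auto
    finally show ?case by (simp add: mult_ac)
  qed (simp add: matpow_0)
  have "summable (\<lambda>k. norm (mat 1 :: real ^ 'n ^ 'n) * (inverse (fact k) * (norm A * K) ^ k))"
    by (intro summable_mult summable_exp)
  then show ?thesis
  proof (rule summable_comparison_test')
    fix k
    show "norm ((1 / fact k) *\<^sub>R matpow A k)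
      \<le> norm (mat 1 :: real ^ 'n ^ 'n) * (inverse (fact k) * (norm A * K) ^ k)"
      using mult_left_mono[OF le[of k], of "inverse (fact k)"]
      by (simp only: norm_scaleR mult.left_commute inverse_eq_divide) simp
  qed
qed

lemma mexp_0: "mexp (0 :: real ^ 'n ^ 'n) = mat 1"
proof -
  have "(1 / fact k) *\<^sub>R matpow (0 :: real ^ 'n ^ 'n) k = (if k = 0 then mat 1 else 0)" for k
    by (cases k) (simp_all add: matpow_0 matpow_Suc)
  then have "mexp (0 :: real ^ 'n ^ 'n) = (\<Sum>k. if k = 0 then mat 1 else 0)"
    by (simp only: mexp_def)
  also have "\<dots> = mat 1" by (subst suminf_finite[of "{0}"]) auto
  finally show ?thesis .
qed

lemma mexp_commute: "A ** mexp (t *\<^sub>R A) = mexp (t *\<^sub>R A) ** A"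
proof -
  note bb = bounded_bilinear_matrix_mult
  have "A ** mexp (t *\<^sub>R A) = (\<Sum>k. A ** ((1 / fact k) *\<^sub>R matpow (t *\<^sub>R A) k))"
    unfolding mexp_def
    by (rule bounded_linear.suminf[OF bounded_bilinear.bounded_linear_right[OF bb] summable_mexp])
  also have "\<dots> = (\<Sum>k. ((1 / fact k) *\<^sub>R matpow (t *\<^sub>R A) k) ** A)"
    by (simp add: matpow_scaleR matpow_commute bounded_bilinear.scaleR_left[OF bb]
        bounded_bilinear.scaleR_right[OF bb])
  also have "\<dots> = mexp (t *\<^sub>R A) ** A"
    unfolding mexp_def
    by (rule bounded_linear.suminf[OF bounded_bilinear.bounded_linear_left[OF bb] summable_mexp,
          symmetric])
  finally show ?thesis .
qed

lemma mexp_scaleR_nth: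
  fixes A :: "real ^ 'n ^ 'n"
  shows "summable (\<lambda>k. (matpow A k $ i $ j / fact k) * t ^ k)"
  "mexp (t *\<^sub>R A) $ i $ j = (\<Sum>k. (matpow A k $ i $ j / fact k) * t ^ k)"
proof -
  have bl: "bounded_linear (\<lambda>X :: real ^ 'n ^ 'n. X $ i $ j)"
    by (intro bounded_linear_compose[OF bounded_linear_vec_nth bounded_linear_vec_nth])
  have eq: "((1 / fact k) *\<^sub>R matpow (t *\<^sub>R A) k) $ i $ j = (matpow A k $ i $ j / fact k) * t ^ k"
    for k by (simp add: matpow_scaleR)
  show "summable (\<lambda>k. (matpow A k $ i $ j / fact k) * t ^ k)"
    using bounded_linear.summable[OF bl summable_mexp[of "t *\<^sub>R A"]] by (simp only: eq)
  show "mexp (t *\<^sub>R A) $ i $ j = (\<Sum>k. (matpow A k $ i $ j / fact k) * t ^ k)"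
    using bounded_linear.suminf[OF bl summable_mexp[of "t *\<^sub>R A"]]
    by (simp only: eq mexp_def)
qed

lemma has_vector_derivative_mexp:
  fixes A :: "real ^ 'n ^ 'n"
  shows "((\<lambda>t. mexp (t *\<^sub>R A)) has_vector_derivative (A ** mexp (t *\<^sub>R A))) (at t within S)"
proof -
  have nth: "((\<lambda>t. mexp (t *\<^sub>R A) $ i $ j) has_real_derivative (A ** mexp (t *\<^sub>R A)) $ i $ j) (at t)"
    for i j
  proof -
    let ?c = "\<lambda>k. matpow A k $ i $ j / fact k"
    have "(\<Sum>k. diffs ?c k * t ^ k)
        = (\<Sum>k. \<Sum>l\<in>UNIV. A $ i $ l * ((matpow A k $ l $ j / fact k) * t ^ k))"
    proof (rule suminf_cong)
      fix k
      have "diffs ?c k = matpow A (Suc k) $ i $ j / fact k"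
        by (simp add: diffs_def field_simps del: of_nat_Suc)
      then show "diffs ?c k * t ^ k = (\<Sum>l\<in>UNIV. A $ i $ l * ((matpow A k $ l $ j / fact k) * t ^ k))"
        by (simp only: matpow_Suc matrix_matrix_mult_def vec_lambda_beta sum_divide_distrib
            sum_distrib_right times_divide_eq_left times_divide_eq_right mult.assoc)
    qed
    also have "\<dots> = (\<Sum>l\<in>UNIV. \<Sum>k. A $ i $ l * ((matpow A k $ l $ j / fact k) * t ^ k))"
      by (rule suminf_sum) (rule summable_mult, rule mexp_scaleR_nth(1))
    also have "\<dots> = (\<Sum>l\<in>UNIV. A $ i $ l * mexp (t *\<^sub>R A) $ l $ j)"
      by (rule sum.cong[OF refl]) (simp only: suminf_mult[OF mexp_scaleR_nth(1)] mexp_scaleR_nth(2))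
    also have "\<dots> = (A ** mexp (t *\<^sub>R A)) $ i $ j"
      by (simp add: matrix_matrix_mult_def)
    finally have eq: "(\<Sum>k. diffs ?c k * t ^ k) = (A ** mexp (t *\<^sub>R A)) $ i $ j" .
    have "((\<lambda>t. \<Sum>k. ?c k * t ^ k) has_real_derivative (\<Sum>k. diffs ?c k * t ^ k)) (at t)"
      by (rule termdiffs_strong_converges_everywhere) (rule mexp_scaleR_nth(1))
    then show ?thesis by (simp only: mexp_scaleR_nth(2) eq)
  qed
  have "((\<lambda>t. mexp (t *\<^sub>R A)) has_derivative (\<lambda>x. x *\<^sub>R (A ** mexp (t *\<^sub>R A)))) (at t)"
    using nth by (subst has_derivative_componentwise_within)
      (auto simp: Basis_vec_def inner_axis has_field_derivative_def mult_commute_abs)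
  then show ?thesis
    unfolding has_vector_derivative_def by (rule has_derivative_at_withinI)
qed

text \<open>The jam-tick rule used in \<open>reaches\<close> below is the solution of the plant under the held
  equilibrium input.\<close>

lemma held_equilibrium_input:
  fixes A :: "real ^ 'n ^ 'n" and B :: "real ^ 'm ^ 'n" and x :: "real \<Rightarrow> real ^ 'n"
  assumes equilibrium: "A *v x_eq + B *v u_eq = 0" and "0 \<le> \<tau>"
    and plant: "\<And>t. t \<in> {0..\<tau>} \<Longrightarrow>
      (x has_vector_derivative (A *v x t + B *v u_eq)) (at t within {0..\<tau>})"
  shows "x \<tau> - x_eq = mexp (\<tau> *\<^sub>R A) *v (x 0 - x_eq)"
proof -
  let ?w = "\<lambda>t. mexp ((\<tau> - t) *\<^sub>R A) *v (x t - x_eq)"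
  have "(?w has_vector_derivative 0) (at t within {0..\<tau>})" if t: "t \<in> {0..\<tau>}" for t
  proof -
    have "B *v u_eq = - (A *v x_eq)" using equilibrium by (simp add: add_eq_0_iff)
    then have y: "((\<lambda>t. x t - x_eq) has_vector_derivative A *v (x t - x_eq)) (at t within {0..\<tau>})"
      using plant[OF t] by (auto intro!: derivative_eq_intros simp: algebra_simps)
    have "((\<lambda>t. \<tau> - t) has_vector_derivative - 1) (at t within {0..\<tau>})"
      by (auto intro!: derivative_eq_intros)
    from vector_diff_chain_within[OF this has_vector_derivative_mexp]
    have E: "((\<lambda>t. mexp ((\<tau> - t) *\<^sub>R A)) has_vector_derivative - (A ** mexp ((\<tau> - t) *\<^sub>R A)))
        (at t within {0..\<tau>})"
      by (simp add: o_def)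
    show ?thesis
      using bounded_bilinear.has_vector_derivative[OF bounded_bilinear_matrix_vector_mult E y]
      by (simp add: matrix_vector_mul_assoc mexp_commute
          bounded_bilinear.minus_left[OF bounded_bilinear_matrix_vector_mult])
  qed
  then obtain c where "\<And>t. t \<in> {0..\<tau>} \<Longrightarrow> ?w t = c"
    using has_vector_derivative_zero_constant[of "{0..\<tau>}" ?w] by (auto simp: convex_real_interval)
  then have "?w 0 = ?w \<tau>" by (simp only: atLeastAtMost_iff \<open>0 \<le> \<tau>\<close> order_refl simp_thms)
  then show ?thesis by (simp add: mexp_0)
qed


section \<open>Lyapunov function and jam-tick gain\<close>

definition sym_pos_def :: "real ^ 'n ^ 'n \<Rightarrow> bool" where
  "sym_pos_def P \<longleftrightarrow> transpose P = P \<and> (\<forall>x. x \<noteq> 0 \<longrightarrow> 0 < x \<bullet> (P *v x))"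

definition V :: "real ^ 'n ^ 'n \<Rightarrow> real ^ 'n \<Rightarrow> real ^ 'n \<Rightarrow> real" where
  "V P x_eq x = (x - x_eq) \<bullet> (P *v (x - x_eq))"

text \<open>The supremum is taken in \<^typ>\<open>real\<close>; for positive definite \<open>P\<close> the set is bounded above
  and nonempty, so this is the genuine supremum.\<close>

definition G1 :: "real ^ 'n ^ 'n \<Rightarrow> real ^ 'n ^ 'n \<Rightarrow> real \<Rightarrow> real" where
  "G1 A P \<tau>min =
     (SUP x\<in>{x. x \<noteq> 0}.
        sqrt ((x \<bullet> ((transpose (mexp (\<tau>min *\<^sub>R A)) ** P ** mexp (\<tau>min *\<^sub>R A)) *v x))
              / (x \<bullet> (P *v x))))"

section \<open>Schedules\<close>

datatype segment = Jam | Unjammed real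

definition is_schedule :: "real \<Rightarrow> nat \<Rightarrow> segment list \<Rightarrow> bool" where
  "is_schedule \<tau>min N\<tau> \<pi> \<longleftrightarrow>
     (\<forall>\<tau>d. Unjammed \<tau>d \<in> set \<pi> \<longrightarrow> (\<exists>k\<in>{1..N\<tau>}. \<tau>d = real k * \<tau>min))"

definition jam_count :: "segment list \<Rightarrow> nat" where
  "jam_count \<pi> = count_list \<pi> Jam"

fun epoch_durations :: "segment list \<Rightarrow> real list" where
  "epoch_durations [] = []"
| "epoch_durations (Jam # \<pi>) = epoch_durations \<pi>"
| "epoch_durations (Unjammed \<tau>d # \<pi>) = \<tau>d # epoch_durations \<pi>"

definition contiguous_block :: "nat \<Rightarrow> segment list" where
  "contiguous_block N = replicate N Jam"

text \<open>\<open>reaches A P x_eq \<tau>min lam \<pi> x y\<close>: the state \<open>y\<close> can be reached from \<open>x\<close> along \<open>\<pi>\<close>.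
  It is a relation because an unjammed epoch is constrained only through the decay of \<open>V\<close>.\<close>

inductive reaches ::
  "real ^ 'n ^ 'n \<Rightarrow> real ^ 'n ^ 'n \<Rightarrow> real ^ 'n \<Rightarrow> real \<Rightarrow> real
    \<Rightarrow> segment list \<Rightarrow> real ^ 'n \<Rightarrow> real ^ 'n \<Rightarrow> bool"
  for A P x_eq \<tau>min lam where
  empty: "reaches A P x_eq \<tau>min lam [] x x"
| jam: "y - x_eq = mexp (\<tau>min *\<^sub>R A) *v (x - x_eq) \<Longrightarrow> reaches A P x_eq \<tau>min lam \<pi> y z
    \<Longrightarrow> reaches A P x_eq \<tau>min lam (Jam # \<pi>) x z"
| unjammed: "V P x_eq y \<le> exp (- lam * \<tau>d) * V P x_eq x \<Longrightarrow> reaches A P x_eq \<tau>min lam \<pi> y z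
    \<Longrightarrow> reaches A P x_eq \<tau>min lam (Unjammed \<tau>d # \<pi>) x z"

definition Vbar ::
  "real ^ 'n ^ 'n \<Rightarrow> real ^ 'n ^ 'n \<Rightarrow> real \<Rightarrow> real \<Rightarrow> real \<Rightarrow> segment list \<Rightarrow> real" where
  "Vbar A P \<tau>min lam V0 \<pi> =
     V0 * G1 A P \<tau>min ^ (2 * jam_count \<pi>) * (\<Prod>\<tau>d\<leftarrow>epoch_durations \<pi>. exp (- lam * \<tau>d))"

end

theory Submission
  imports Defs
begin

text \<open>Every segment multiplies \<open>V\<close> by at most a fixed nonnegative factor. For an
  unjammed epoch this is the decay contract. For a jam tick the factor is the square of
  \<open>G1\<close>, because \<open>G1\<close> is the operator norm of the tick map with respect to
  the norm induced by \<open>P\<close> (\<open>jam_tick_gain\<close>). Scalar factors commute, so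
  the order of the segments is irrelevant and induction along the run gives the bound
  \<open>Vbar\<close> (\<open>reaches_le_Vbar\<close>). The analytic point is that \<open>G1\<close>
  is a real supremum, usable as an upper bound only once the gains are known to be bounded
  (\<open>bdd_above_jam_gain\<close>); this rests on coercivity of \<open>P\<close>. For maximality,
  each decay factor is at most 1 and multiplies a nonnegative quantity, so deleting all epochs can
  only raise \<open>Vbar\<close> (\<open>Vbar_le_contiguous\<close>).\<close>

lemma quadratic_form_scaleR:
  fixes P :: "real ^ 'n ^ 'n"
  shows "(c *\<^sub>R x) \<bullet> (P *v (c *\<^sub>R x)) = c\<^sup>2 * (x \<bullet> (P *v x))"
  by (simp add: matrix_vector_mult_scaleR power2_eq_square)

lemma quadratic_form_congruence:
  fixes P M :: "real ^ 'n ^ 'n"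
  shows "x \<bullet> ((transpose M ** P ** M) *v x) = (M *v x) \<bullet> (P *v (M *v x))"
proof -
  have "x \<bullet> ((transpose M ** P ** M) *v x) = x \<bullet> (transpose M *v (P *v (M *v x)))"
    by (simp only: matrix_vector_mul_assoc matrix_mul_assoc)
  then show ?thesis
    by (metis dot_lmul_matrix inner_commute transpose_matrix_vector)
qed

lemma sym_pos_def_nonneg: "sym_pos_def P \<Longrightarrow> 0 \<le> x \<bullet> (P *v x)"
  by (cases "x = 0") (auto simp: sym_pos_def_def intro: less_imp_le)

text \<open>By compactness the form attains a minimum on the unit sphere, and positive definiteness
  makes it positive. This minimum is \<open>m\<close>; homogeneity of degree 2 carries the bound to
  all vectors.\<close>

lemma sym_pos_def_coercive:
  fixes P :: "real ^ 'n ^ 'n"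
  assumes "sym_pos_def P"
  obtains m where "m > 0" "\<And>x. m * (norm x)\<^sup>2 \<le> x \<bullet> (P *v x)"
proof -
  let ?S = "sphere (0 :: real ^ 'n) 1"
  have "continuous_on ?S (\<lambda>x. x \<bullet> (P *v x))"
    by (intro continuous_intros bounded_linear.continuous_on[OF matrix_vector_mul_bounded_linear])
  then obtain u where u: "u \<in> ?S" "\<And>x. x \<in> ?S \<Longrightarrow> u \<bullet> (P *v u) \<le> x \<bullet> (P *v x)"
    using continuous_attains_inf[of ?S "\<lambda>x. x \<bullet> (P *v x)"] by (force simp del: mem_sphere)
  have "u \<noteq> 0" using u(1) by auto
  moreover have "(u \<bullet> (P *v u)) * (norm x)\<^sup>2 \<le> x \<bullet> (P *v x)" for x
  proof (cases "x = 0")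
    case False
    have "x \<bullet> (P *v x) = (norm x)\<^sup>2 * (sgn x \<bullet> (P *v sgn x))"
      using quadratic_form_scaleR[of "norm x" "sgn x" P] False by (simp add: sgn_div_norm)
    moreover have "u \<bullet> (P *v u) \<le> sgn x \<bullet> (P *v sgn x)"
      using False by (intro u(2)) (simp add: norm_sgn)
    ultimately show ?thesis by (metis mult.commute mult_right_mono zero_le_power2)
  qed simp
  ultimately show thesis
    using that[of "u \<bullet> (P *v u)"] assms by (auto simp: sym_pos_def_def)
qed

text \<open>Cauchy-Schwarz and the operator norm bound the numerator by a multiple of the squared
  norm of \<open>x\<close>, coercivity bounds the denominator below by another, and the squared
  norms cancel.\<close>

lemma bdd_above_jam_gain:
  fixes P M :: "real ^ 'n ^ 'n"
  assumes "sym_pos_def P"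
  shows "bdd_above ((\<lambda>x. sqrt ((x \<bullet> ((transpose M ** P ** M) *v x)) / (x \<bullet> (P *v x)))) ` {x. x \<noteq> 0})"
proof -
  let ?Q = "transpose M ** P ** M"
  obtain m where m: "m > 0" "\<And>x. m * (norm x)\<^sup>2 \<le> x \<bullet> (P *v x)"
    using sym_pos_def_coercive[OF assms] by blast
  have "sqrt ((x \<bullet> (?Q *v x)) / (x \<bullet> (P *v x))) \<le> sqrt (onorm ((*v) ?Q) / m)"
    if "x \<noteq> 0" for x
  proof -
    have "0 < m * (norm x)\<^sup>2" using m(1) that by simp
    have "x \<bullet> (?Q *v x) \<le> norm x * norm (?Q *v x)" by (rule norm_cauchy_schwarz)
    also have "\<dots> \<le> norm x * (onorm ((*v) ?Q) * norm x)"
      by (intro mult_left_mono onorm matrix_vector_mul_bounded_linear) simp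
    finally have "x \<bullet> (?Q *v x) \<le> onorm ((*v) ?Q) * (norm x)\<^sup>2"
      by (simp add: power2_eq_square mult_ac)
    \<comment> \<open>Replacing the denominator by a smaller one enlarges the fraction only if the
      bounding numerator is nonnegative.\<close>
    moreover have "0 \<le> onorm ((*v) ?Q) * (norm x)\<^sup>2"
      by (simp add: onorm_pos_le matrix_vector_mul_bounded_linear)
    ultimately have "(x \<bullet> (?Q *v x)) / (x \<bullet> (P *v x)) \<le> (onorm ((*v) ?Q) * (norm x)\<^sup>2) / (m * (norm x)\<^sup>2)"
      using m(2)[of x] \<open>0 < m * (norm x)\<^sup>2\<close> by (intro frac_le) auto
    then show ?thesis using that by simp
  qed
  then show ?thesis by (intro bdd_aboveI2[where M = "sqrt (onorm ((*v) ?Q) / m)"]) blast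
qed

text \<open>The deviation \<open>x - x_eq\<close> is one of the competitors in the supremum
  \<open>G1\<close>, and its gain is the root of the ratio of \<open>V\<close> after and before the
  tick. A zero deviation, which the supremum excludes, stays zero.\<close>

lemma jam_tick_gain:
  fixes A P :: "real ^ 'n ^ 'n"
  assumes P: "sym_pos_def P"
    and y: "y - x_eq = mexp (\<tau>min *\<^sub>R A) *v (x - x_eq)"
  shows "V P x_eq y \<le> (G1 A P \<tau>min)\<^sup>2 * V P x_eq x"
proof (cases "x = x_eq")
  case True
  with y show ?thesis by (simp add: V_def)
next
  case False
  let ?M = "mexp (\<tau>min *\<^sub>R A)" and ?d = "x - x_eq"
  have pos: "0 < ?d \<bullet> (P *v ?d)" using P False by (simp add: sym_pos_def_def)
  have Vy: "V P x_eq y = ?d \<bullet> ((transpose ?M ** P ** ?M) *v ?d)"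
    by (simp only: V_def y quadratic_form_congruence)
  have "sqrt (V P x_eq y / V P x_eq x) \<le> G1 A P \<tau>min"
    unfolding G1_def Vy V_def[of P x_eq x]
    by (rule cSUP_upper[OF _ bdd_above_jam_gain[OF P]]) (use False in simp)
  then have "V P x_eq y / V P x_eq x \<le> (G1 A P \<tau>min)\<^sup>2"
    by (rule sqrt_le_D)
  then show ?thesis using pos by (simp add: V_def pos_divide_le_eq)
qed

text \<open>The factor of the first segment is absorbed into the initial value, matching how
  \<open>reaches\<close> moves its start state.\<close>

lemma Vbar_Nil: "Vbar A P \<tau>min lam V0 [] = V0"
  and Vbar_Jam: "Vbar A P \<tau>min lam V0 (Jam # \<pi>) = Vbar A P \<tau>min lam ((G1 A P \<tau>min)\<^sup>2 * V0) \<pi>"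
  and Vbar_Unjammed:
    "Vbar A P \<tau>min lam V0 (Unjammed \<tau>d # \<pi>) = Vbar A P \<tau>min lam (exp (- lam * \<tau>d) * V0) \<pi>"
  by (simp_all add: Vbar_def jam_count_def power2_eq_square mult_ac)

lemma prod_list_exp_pos: "0 < (\<Prod>t\<leftarrow>ts. exp (f t :: real))"
  by (induction ts) auto

text \<open>The coefficient of the initial value is nonnegative: an even power of \<open>G1\<close>
  times a product of exponentials.\<close>

lemma Vbar_mono: "V0 \<le> V1 \<Longrightarrow> Vbar A P \<tau>min lam V0 \<pi> \<le> Vbar A P \<tau>min lam V1 \<pi>"
  unfolding Vbar_def
  by (intro mult_right_mono) (auto simp: less_imp_le[OF prod_list_exp_pos])

lemma reaches_le_Vbar:
  assumes "sym_pos_def P" "reaches A P x_eq \<tau>min lam \<pi> x z"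
  shows "V P x_eq z \<le> Vbar A P \<tau>min lam (V P x_eq x) \<pi>"
  using assms(2)
proof (induction rule: reaches.induct)
  case (empty x)
  show ?case by (simp add: Vbar_Nil)
next
  case (jam y x \<pi> z)
  then show ?case
    unfolding Vbar_Jam by (blast intro: order_trans Vbar_mono jam_tick_gain[OF assms(1)])
next
  case (unjammed y \<tau>d x \<pi> z)
  then show ?case
    unfolding Vbar_Unjammed by (blast intro: order_trans Vbar_mono)
qed

lemma set_epoch_durations: "set (epoch_durations \<pi>) = {\<tau>d. Unjammed \<tau>d \<in> set \<pi>}"
  by (induction \<pi> rule: epoch_durations.induct) auto

lemma prod_list_decay_le_1:
  assumes "lam \<ge> 0" "\<And>t. t \<in> set ts \<Longrightarrow> t \<ge> 0"
  shows "(\<Prod>t\<leftarrow>ts. exp (- lam * t :: real)) \<le> 1"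
  using assms(2)
  by (induction ts) (auto intro!: mult_le_one simp: assms(1) less_imp_le[OF prod_list_exp_pos])

lemma Vbar_le_contiguous:
  assumes "is_schedule \<tau>min N\<tau> \<pi>" "\<tau>min \<ge> 0" "lam \<ge> 0" "V0 \<ge> 0"
  shows "Vbar A P \<tau>min lam V0 \<pi> \<le> V0 * G1 A P \<tau>min ^ (2 * jam_count \<pi>)"
proof -
  have "(\<Prod>\<tau>d\<leftarrow>epoch_durations \<pi>. exp (- lam * \<tau>d)) \<le> 1"
    using assms by (intro prod_list_decay_le_1) (auto simp: set_epoch_durations is_schedule_def)
  then show ?thesis
    unfolding Vbar_def using assms(4) by (intro mult_left_le) auto
qed

lemma jam_count_contiguous_block: "jam_count (contiguous_block N) = N"
  by (induction N) (auto simp: jam_count_def contiguous_block_def)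

lemma is_schedule_contiguous_block: "is_schedule \<tau>min N\<tau> (contiguous_block N)"
  by (simp add: is_schedule_def contiguous_block_def)

lemma Vbar_contiguous_block: "Vbar A P \<tau>min lam V0 (contiguous_block N) = V0 * G1 A P \<tau>min ^ (2 * N)"
proof -
  have "epoch_durations (contiguous_block N) = []"
    by (induction N) (auto simp: contiguous_block_def)
  then show ?thesis by (simp add: Vbar_def jam_count_contiguous_block)
qed

theorem corollary1:
  fixes A P :: "real ^ 'n ^ 'n" and x_eq x0 :: "real ^ 'n"
    and \<tau>min lam V0 :: real and N\<tau> :: nat
  assumes "sym_pos_def P"
    and "\<tau>min > 0"
    and "lam > 0"
    and "N\<tau> \<ge> 1"
    and "V P x_eq x0 = V0"
  shows "(\<forall>\<pi> xT. is_schedule \<tau>min N\<tau> \<pi> \<and> reaches A P x_eq \<tau>min lam \<pi> x0 xT \<longrightarrow>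
            V P x_eq xT \<le> Vbar A P \<tau>min lam V0 \<pi>)
       \<and> (\<forall>N. is_arg_max (Vbar A P \<tau>min lam V0)
                (\<lambda>\<pi>. is_schedule \<tau>min N\<tau> \<pi> \<and> jam_count \<pi> = N) (contiguous_block N)
            \<and> Vbar A P \<tau>min lam V0 (contiguous_block N) = V0 * G1 A P \<tau>min ^ (2 * N))"
proof (intro conjI allI impI)
  fix \<pi> xT
  assume "is_schedule \<tau>min N\<tau> \<pi> \<and> reaches A P x_eq \<tau>min lam \<pi> x0 xT"
  then show "V P x_eq xT \<le> Vbar A P \<tau>min lam V0 \<pi>"
    using reaches_le_Vbar[OF assms(1)] assms(5) by blast
next
  fix N
  \<comment> \<open>As a value of \<open>V\<close>, the initial value inherits its sign from the
    form of \<open>P\<close>.\<close>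
  have "V0 \<ge> 0"
    using sym_pos_def_nonneg[OF assms(1)] assms(5) by (auto simp: V_def)
  \<comment> \<open>With the jam count fixed at \<open>N\<close>, the bound of
    \<open>Vbar_le_contiguous\<close> is exactly the value of \<open>Vbar\<close> at the block,
    which is itself an admissible schedule.\<close>
  then show "is_arg_max (Vbar A P \<tau>min lam V0)
      (\<lambda>\<pi>. is_schedule \<tau>min N\<tau> \<pi> \<and> jam_count \<pi> = N) (contiguous_block N)"
    using Vbar_le_contiguous[of \<tau>min N\<tau> _ lam V0 A P] assms(2,3)
    by (auto simp: is_arg_max_linorder is_schedule_contiguous_block jam_count_contiguous_block
        Vbar_contiguous_block)
  show "Vbar A P \<tau>min lam V0 (contiguous_block N) = V0 * G1 A P \<tau>min ^ (2 * N)"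
    by (rule Vbar_contiguous_block)
qed

end
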